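(* Let $0\le a<b$ and $0\le c<d$ be real numbers, and let $M=[a,b)$ and $N=[c,d)$ be the corresponding interval modules. Set $$\sigma=\begin{cases}\min(S_{M,N}), & S_{M,N}\ne\emptyset\\ 0, & S_{M,N}=\emptyset\end{cases}\qquad \tau=\begin{cases}\min(S_{N,M}), & S_{N,M}\ne\emptyset\\ 0, & S_{N,M}=\emptyset\end{cases}$$ $$\sigma'=\begin{cases}\sup(S_{M,N}), & S_{M,N}\ne\emptyset\\ 0, & S_{M,N}=\emptyset\end{cases}\qquad \tau'=\begin{cases}\sup(S_{N,M}), & S_{N,M}\ne\emptyset\\ 0, & S_{N,M}=\emptyset\end{cases}$$ Thus, for $x\ge 0$, $H(M,Nx)\neq\{0\}$ if and only if $S_{M,N}\ne\emptyset$ and $\sigma\le x<\sigma'$, and similarly $H(N,Mx)\ne\{0\}$ if and only if $S_{N,M}\ne\emptyset$ and $\tau\le x<\tau'$. Then: (i) $\max\{|a-c|,|b-d|\}=\max\{\sigma,\tau\}$ (so this is the value at which the last homomorphism between $M$ and $N$ is born). (ii) $\max\{|a-d|,|b-c|\}=\max\{\sigma',\tau'\}$ (so this is the value at which the last homomorphism between $M$ and $N$ dies).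
   Context: A persistence module $M$ assigns to each $x\in[0,\infty)$ a real vector space $M(x)$ and to each $x\le y$ a linear map $M(x\le y):M(x)\to M(y)$ with $M(x\le z)=M(y\le z)\circ M(x\le y)$ for $x\le y\le z$. A morphism $F:M\to N$ is a family of linear maps $F(x):M(x)\to N(x)$, $x\in[0,\infty)$, with $F(y)\circ M(x\le y)=N(x\le y)\circ F(x)$ for $x\le y$; $H(M,N)$ (also written $Hom(M,N)$) denotes the vector space of morphisms $M\to N$. For $\epsilon\ge 0$ the shift $M\epsilon$ is the persistence module $(M\epsilon)(x)=M(x+\epsilon)$, with the corresponding structure maps. For $0\le\alpha<\beta$, the interval module $[\alpha,\beta)$ is the persistence module equal to $\mathbb{R}$ at $x\in[\alpha,\beta)$ and $0$ elsewhere, with structure maps the identity when $x,y\in[\alpha,\beta)$ and $0$ otherwise. For persistence modules $M,N$ set $$S_{M,N}=\{x\ge 0 : H(M,Nx)\ne\{0\}\}.$$ For interval modules, $S_{M,N}$ is either empty or an interval of the form $[r,s)$ with $r<s$, so its minimum exists when it is nonempty. *)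

theory Defs
  imports Complex_Main
begin

text \<open>
  The spaces \<open>M(x)\<close> are linear subspaces of one ambient real vector space \<open>'v\<close>. This is no
  restriction: every family of vector spaces embeds into its direct sum. Only indices
  \<open>x \<ge> 0\<close>, pairs \<open>0 \<le> x \<le> y\<close>, and the values of the structure maps on \<open>M(x)\<close> are meaningful.
\<close>

record 'v pers_module =
  pspace :: "real \<Rightarrow> 'v set"
  pmap :: "real \<Rightarrow> real \<Rightarrow> 'v \<Rightarrow> 'v"

definition linear_between ::
  "'v::real_vector set \<Rightarrow> 'w::real_vector set \<Rightarrow> ('v \<Rightarrow> 'w) \<Rightarrow> bool" where
  "linear_between V W f \<longleftrightarrow>
     (\<forall>u\<in>V. f u \<in> W) \<and>
     (\<forall>u\<in>V. \<forall>v\<in>V. f (u + v) = f u + f v) \<and>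
     (\<forall>k. \<forall>u\<in>V. f (k *\<^sub>R u) = k *\<^sub>R f u)"

definition persistence_module :: "'v::real_vector pers_module \<Rightarrow> bool" where
  "persistence_module M \<longleftrightarrow>
     (\<forall>x\<ge>0. subspace (pspace M x)) \<and>
     (\<forall>x y. 0 \<le> x \<and> x \<le> y \<longrightarrow> linear_between (pspace M x) (pspace M y) (pmap M x y)) \<and>
     (\<forall>x y z. 0 \<le> x \<and> x \<le> y \<and> y \<le> z \<longrightarrow>
        (\<forall>v\<in>pspace M x. pmap M x z v = pmap M y z (pmap M x y v)))"

text \<open>
  Morphisms are normalised to be \<open>0\<close> where they carry no information (negative indices and
  arguments outside \<open>M(x)\<close>), so that equality of functions is equality of morphisms and the
  zero morphism is the constant function \<open>0\<close>.
\<close>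

definition Hom ::
  "'v::real_vector pers_module \<Rightarrow> 'w::real_vector pers_module \<Rightarrow> (real \<Rightarrow> 'v \<Rightarrow> 'w) set" where
  "Hom M N = {F.
     (\<forall>x\<ge>0. linear_between (pspace M x) (pspace N x) (F x)) \<and>
     (\<forall>x y. 0 \<le> x \<and> x \<le> y \<longrightarrow>
        (\<forall>v\<in>pspace M x. F y (pmap M x y v) = pmap N x y (F x v))) \<and>
     (\<forall>x v. x < 0 \<or> v \<notin> pspace M x \<longrightarrow> F x v = 0)}"

definition zero_morphism :: "real \<Rightarrow> 'v \<Rightarrow> 'w::real_vector" where
  "zero_morphism = (\<lambda>x v. 0)"

definition shift :: "'v pers_module \<Rightarrow> real \<Rightarrow> 'v pers_module" where
  "shift M \<epsilon> = \<lparr>pspace = (\<lambda>x. pspace M (x + \<epsilon>)), pmap = (\<lambda>x y. pmap M (x + \<epsilon>) (y + \<epsilon>))\<rparr>"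

definition interval_module :: "real \<Rightarrow> real \<Rightarrow> real pers_module" where
  "interval_module \<alpha> \<beta> =
     \<lparr>pspace = (\<lambda>x. if x \<in> {\<alpha>..<\<beta>} then UNIV else {0}),
      pmap = (\<lambda>x y v. if x \<in> {\<alpha>..<\<beta>} \<and> y \<in> {\<alpha>..<\<beta>} then v else 0)\<rparr>"

definition hom_shifts ::
  "'v::real_vector pers_module \<Rightarrow> 'w::real_vector pers_module \<Rightarrow> real set" where
  "hom_shifts M N = {x. 0 \<le> x \<and> Hom M (shift N x) \<noteq> {zero_morphism}}"

lemma persistence_module_interval: "persistence_module (interval_module \<alpha> \<beta>)"
  by (auto simp: persistence_module_def interval_module_def linear_between_def subspace_def)

lemma persistence_module_shift:
  assumes "persistence_module M" "0 \<le> \<epsilon>"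
  shows "persistence_module (shift M \<epsilon>)"
  using assms by (auto simp: persistence_module_def shift_def)

lemma linear_between_zero: "subspace W \<Longrightarrow> linear_between V W (\<lambda>v. 0)"
  by (simp add: linear_between_def subspace_def)

lemma linear_between_0: "linear_between V W f \<Longrightarrow> subspace V \<Longrightarrow> f 0 = 0"
  unfolding linear_between_def subspace_def by (metis scaleR_zero_left)

lemma zero_morphism_in_Hom:
  assumes "persistence_module M" "persistence_module N"
  shows "zero_morphism \<in> Hom M N"
proof -
  have "pmap N x y 0 = 0" if "0 \<le> x" "x \<le> y" for x y
    using assms(2) that linear_between_0 unfolding persistence_module_def by blast
  then show ?thesis
    using assms by (auto simp: Hom_def zero_morphism_def persistence_module_def
        intro!: linear_between_zero)
qed

lemma Hom_add:
  assumes N: "persistence_module N" and F: "F \<in> Hom M N" and G: "G \<in> Hom M N"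
  shows "(\<lambda>x v. F x v + G x v) \<in> Hom M N"
proof -
  have "linear_between (pspace M x) (pspace N x) (\<lambda>v. F x v + G x v)" if "0 \<le> x" for x
    using assms that
    by (auto simp: Hom_def persistence_module_def linear_between_def subspace_def
        scaleR_add_right algebra_simps)
  moreover have "F y (pmap M x y v) + G y (pmap M x y v) = pmap N x y (F x v + G x v)"
    if "0 \<le> x" "x \<le> y" "v \<in> pspace M x" for x y v
    using assms that by (simp add: Hom_def persistence_module_def linear_between_def)
  ultimately show ?thesis
    using F G by (simp add: Hom_def)
qed

lemma Hom_scale:
  assumes N: "persistence_module N" and F: "F \<in> Hom M N"
  shows "(\<lambda>x v. k *\<^sub>R F x v) \<in> Hom M N"
proof -
  have "linear_between (pspace M x) (pspace N x) (\<lambda>v. k *\<^sub>R F x v)" if "0 \<le> x" for x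
    using assms that
    by (auto simp: Hom_def persistence_module_def linear_between_def subspace_def
        scaleR_add_right)
  moreover have "k *\<^sub>R F y (pmap M x y v) = pmap N x y (k *\<^sub>R F x v)"
    if "0 \<le> x" "x \<le> y" "v \<in> pspace M x" for x y v
    using assms that by (simp add: Hom_def persistence_module_def linear_between_def)
  ultimately show ?thesis
    using F by (simp add: Hom_def)
qed

end

theory Submission
  imports Defs
begin

text \<open>
  A morphism \<open>F\<close> from \<open>[a, b)\<close> to the shift of \<open>[c, d)\<close> by \<open>x\<close> is determined by its value at \<open>a\<close>.
  If that value is nonzero, then \<open>a + x\<close> lies in \<open>[c, d)\<close>, and it must die in the shifted module
  no later than at \<open>b\<close>, which means \<open>d \<le> b + x\<close>. Hence the set of admissible shifts is the interval
  from \<open>max 0 (max (c - a) (d - b))\<close> (included) to \<open>d - a\<close> (excluded), and both identities compare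
  the endpoints of this interval with those obtained by exchanging the modules. The two sets of
  shifts cannot both be empty.
\<close>

text \<open>\<open>Hom M N\<close> always contains the zero morphism, so it can differ from
  \<open>{zero_morphism}\<close> only by containing a further element, never by being empty.\<close>

lemma Hom_nontrivial_iff:
  assumes "persistence_module M" "persistence_module N"
  shows "Hom M N \<noteq> {zero_morphism} \<longleftrightarrow> (\<exists>F\<in>Hom M N. \<exists>t v. F t v \<noteq> 0)"
proof -
  have "F \<noteq> zero_morphism \<longleftrightarrow> (\<exists>t v. F t v \<noteq> 0)" for F :: "real \<Rightarrow> 'a \<Rightarrow> 'b"
    by (auto simp: zero_morphism_def fun_eq_iff)
  then show ?thesis
    using zero_morphism_in_Hom[OF assms] by blast
qed

lemma Hom_interval_shift_nonzeroD:
  assumes "0 \<le> a" "a < b" "0 \<le> x"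
    and F: "F \<in> Hom (interval_module a b) (shift (interval_module c d) x)"
    and nz: "F t v \<noteq> 0"
  shows "c \<le> a + x \<and> d \<le> b + x \<and> a + x < d"
proof -
  let ?M = "interval_module a b" and ?N = "shift (interval_module c d) x"
  have lin: "linear_between (pspace ?M s) (pspace ?N s) (F s)" if "0 \<le> s" for s
    using F that by (simp add: Hom_def)
  have nat: "F u (pmap ?M s u w) = pmap ?N s u (F s w)"
    if "0 \<le> s" "s \<le> u" "w \<in> pspace ?M s" for s u w
    using F that by (simp add: Hom_def)
  have F0: "F s 0 = 0" if "0 \<le> s" for s
    using linear_between_0[OF lin[OF that]] that persistence_module_interval[of a b]
    by (simp add: persistence_module_def)
  have "F t v = 0" if "t < 0 \<or> v \<notin> pspace ?M t"
    using F that unfolding Hom_def by blast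
  with nz have t: "0 \<le> t" "v \<in> pspace ?M t"
    by force+
  moreover have "v \<noteq> 0"
    using nz F0[OF t(1)] by blast
  ultimately have ab: "t \<in> {a..<b}"
    by (auto simp: interval_module_def split: if_splits)
  \<comment> \<open>Naturality from the birth \<open>a\<close> up to \<open>t\<close>: the structure
    map of the source is the identity here, so \<open>F t v\<close> is the image of
    \<open>F a v\<close>.\<close>
  have "F t (pmap ?M a t v) = pmap ?N a t (F a v)"
    using assms ab by (intro nat) (auto simp: interval_module_def)
  then have Fa: "F t v = pmap ?N a t (F a v)"
    using assms ab by (simp add: interval_module_def)
  with nz have ax: "a + x \<in> {c..<d}" and Fa_nz: "F a v \<noteq> 0"
    by (auto simp: shift_def interval_module_def split: if_splits)
  \<comment> \<open>The source is zero at \<open>b\<close>, so the target must send the nonzero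
    \<open>F a v\<close> to 0. As \<open>c \<le> a + x < b + x\<close>, this is possible only if
    \<open>b + x\<close> has passed \<open>d\<close>.\<close>
  have "F b (pmap ?M a b v) = pmap ?N a b (F a v)"
    using assms by (intro nat) (auto simp: interval_module_def)
  then have "pmap ?N a b (F a v) = 0"
    using F0[of b] assms by (simp add: interval_module_def)
  with ax Fa_nz assms have "d \<le> b + x"
    by (auto simp: shift_def interval_module_def split: if_splits)
  with ax show ?thesis
    by simp
qed

text \<open>This is the identity wherever source and target are both alive. The conditions
  \<open>t < b\<close> and \<open>c \<le> t + x\<close> follow from the guard and the hypotheses, so
  the guard omits them.\<close>

lemma Hom_interval_shift_witness:
  assumes "0 \<le> a" "c \<le> a + x" "d \<le> b + x"
  shows "(\<lambda>t v. if a \<le> t \<and> t + x < d then v else 0)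
           \<in> Hom (interval_module a b) (shift (interval_module c d) x)"
  using assms by (auto simp: Hom_def linear_between_def shift_def interval_module_def)

lemma hom_shifts_interval:
  assumes "0 \<le> a" "a < b"
  shows "hom_shifts (interval_module a b) (interval_module c d)
           = {max 0 (max (c - a) (d - b))..<d - a}"
proof -
  have "Hom (interval_module a b) (shift (interval_module c d) x) \<noteq> {zero_morphism}
          \<longleftrightarrow> c \<le> a + x \<and> d \<le> b + x \<and> a + x < d" (is "?L \<longleftrightarrow> ?R") if "0 \<le> x" for x
  proof -
    have "?L \<longleftrightarrow> (\<exists>F\<in>Hom (interval_module a b) (shift (interval_module c d) x). \<exists>t v. F t v \<noteq> 0)"
      using that
      by (intro Hom_nontrivial_iff persistence_module_shift persistence_module_interval)
    also have "\<dots> \<longleftrightarrow> ?R"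
    proof
      assume ?R
      with assms Hom_interval_shift_witness[of a c x d b] show
        "\<exists>F\<in>Hom (interval_module a b) (shift (interval_module c d) x). \<exists>t v. F t v \<noteq> 0"
        by (intro bexI exI[of _ a] exI[of _ 1]) auto
    qed (use Hom_interval_shift_nonzeroD assms that in blast)
    finally show ?thesis .
  qed
  then have "hom_shifts (interval_module a b) (interval_module c d)
      = {x. 0 \<le> x \<and> c \<le> a + x \<and> d \<le> b + x \<and> a + x < d}"
    unfolding hom_shifts_def by (intro Collect_cong conj_cong refl)
  then show ?thesis
    by (simp only: set_eq_iff mem_Collect_eq atLeastLessThan_iff max.bounded_iff) linarith
qed

lemma Least_atLeastLessThan: "(LEAST x. x \<in> {l..<u}) = l" if "l < u" for l u :: real
  using that by (intro Least_equality) auto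

theorem proposition15:
  fixes a b c d \<sigma> \<tau> \<sigma>' \<tau>' :: real
    and M N :: "real pers_module"
  assumes "0 \<le> a" and "a < b" and "0 \<le> c" and "c < d"
    and "M = interval_module a b" and "N = interval_module c d"
    and "\<sigma> = (if hom_shifts M N \<noteq> {} then LEAST x. x \<in> hom_shifts M N else 0)"
    and "\<tau> = (if hom_shifts N M \<noteq> {} then LEAST x. x \<in> hom_shifts N M else 0)"
    and "\<sigma>' = (if hom_shifts M N \<noteq> {} then Sup (hom_shifts M N) else 0)"
    and "\<tau>' = (if hom_shifts N M \<noteq> {} then Sup (hom_shifts N M) else 0)"
  shows "(\<forall>x\<ge>0. Hom M (shift N x) \<noteq> {zero_morphism} \<longleftrightarrow>
              hom_shifts M N \<noteq> {} \<and> \<sigma> \<le> x \<and> x < \<sigma>') \<and>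
         (\<forall>x\<ge>0. Hom N (shift M x) \<noteq> {zero_morphism} \<longleftrightarrow>
              hom_shifts N M \<noteq> {} \<and> \<tau> \<le> x \<and> x < \<tau>') \<and>
         max \<bar>a - c\<bar> \<bar>b - d\<bar> = max \<sigma> \<tau> \<and>
         max \<bar>a - d\<bar> \<bar>b - c\<bar> = max \<sigma>' \<tau>'"
proof -
  let ?l = "\<lambda>a b c d. max 0 (max (c - a) (d - b)) :: real"
  have S: "hom_shifts M N = {?l a b c d..<d - a}" "hom_shifts N M = {?l c d a b..<b - c}"
    using assms by (simp_all add: hom_shifts_interval)
  \<comment> \<open>Of the three lower bounds, \<open>c - a\<close> and \<open>d - b\<close> lie
    below \<open>d - a\<close> because \<open>c < d\<close> and \<open>a < b\<close>; only
    \<open>0 < d - a\<close> remains to be required.\<close>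
  have ne: "hom_shifts M N \<noteq> {} \<longleftrightarrow> a < d" "hom_shifts N M \<noteq> {} \<longleftrightarrow> c < b"
    unfolding S using assms(2,4) by auto
  have \<sigma>: "\<sigma> = (if a < d then ?l a b c d else 0)"
    and \<sigma>': "\<sigma>' = (if a < d then d - a else 0)"
    unfolding assms(7,9) ne unfolding S using assms(2,4)
    by (auto simp: Least_atLeastLessThan simp del: atLeastLessThan_iff)
  have \<tau>: "\<tau> = (if c < b then ?l c d a b else 0)"
    and \<tau>': "\<tau>' = (if c < b then b - c else 0)"
    unfolding assms(8,10) ne unfolding S using assms(2,4)
    by (auto simp: Least_atLeastLessThan simp del: atLeastLessThan_iff)
  \<comment> \<open>The fourth combination would give \<open>c < d \<le> a < b \<le> c\<close>. If
    one set of shifts is empty, its default 0 does not affect the maxima, since the endpoints of the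
    other are nonnegative.\<close>
  consider "a < d" "c < b" | "d \<le> a" "c < b" | "a < d" "b \<le> c"
    using assms(2,4) by linarith
  then have "max \<bar>a - c\<bar> \<bar>b - d\<bar> = max \<sigma> \<tau> \<and> max \<bar>a - d\<bar> \<bar>b - c\<bar> = max \<sigma>' \<tau>'"
    by cases (use assms(2,4) in \<open>simp_all add: \<sigma> \<tau> \<sigma>' \<tau>' abs_real_def max_def\<close>)
  moreover have "Hom M (shift N x) \<noteq> {zero_morphism} \<longleftrightarrow> hom_shifts M N \<noteq> {} \<and> \<sigma> \<le> x \<and> x < \<sigma>'"
    if "0 \<le> x" for x
  proof -
    have "Hom M (shift N x) \<noteq> {zero_morphism} \<longleftrightarrow> x \<in> hom_shifts M N"
      using that by (simp add: hom_shifts_def)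
    with that show ?thesis
      unfolding ne S \<sigma> \<sigma>' by auto
  qed
  moreover have "Hom N (shift M x) \<noteq> {zero_morphism} \<longleftrightarrow> hom_shifts N M \<noteq> {} \<and> \<tau> \<le> x \<and> x < \<tau>'"
    if "0 \<le> x" for x
  proof -
    have "Hom N (shift M x) \<noteq> {zero_morphism} \<longleftrightarrow> x \<in> hom_shifts N M"
      using that by (simp add: hom_shifts_def)
    with that show ?thesis
      unfolding ne S \<tau> \<tau>' by auto
  qed
  ultimately show ?thesis
    by blast
qed

end
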